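(* For $n\in\mathbb{Z}$ let $$K_{\mathrm d}(n)=\frac1\pi\int_0^\pi\rho(\theta)^{1/2}\sin\bigl((n+\tfrac12)\theta\bigr)\,d\theta,\qquad K_{H^+}(n)=\frac{1}{\pi(n+\frac12)},\qquad D(n)=K_{\mathrm d}(n)-K_{H^+}(n),$$ where $\rho(\theta)=2-\cos\theta-\sqrt{(2-\cos\theta)^2-1}$. Then $D\in\ell^1(\mathbb{Z})$; the asymptotic formula $$K_{\mathrm d}(n)=\frac{1}{\pi(n+\frac12)}+O(n^{-2})\qquad(|n|\to\infty)$$ holds; and for every $1\le p\le\infty$, $$\|H_{\mathrm d}-H^+\|_{\ell^p\to\ell^p}\le\|D\|_{\ell^1}<\infty,$$ where $H_{\mathrm d}$ and $H^+$ are the convolution operators on sequences over $\mathbb{Z}$ with kernels $K_{\mathrm d}$ and $K_{H^+}$ respectively, and $H_{\mathrm d}-H^+$ is the operator $a\mapsto D*a$.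
   Context: For kernels $K$ and sequences $a$ on $\mathbb{Z}$, $(K*a)(n)=\sum_{m\in\mathbb{Z}}K(n-m)a_m$. $H_{\mathrm d}$ is the discrete Hilbert transform with Fourier multiplier $(-\mathrm{i}\,\operatorname{sgn}\theta)\rho(\theta)^{1/2}e^{\mathrm{i}\theta/2}$, i.e. $K_{\mathrm d}(n)=\frac1{2\pi}\int_{-\pi}^{\pi}(-\mathrm{i}\,\operatorname{sgn}\theta)\rho(\theta)^{1/2}e^{\mathrm{i}(n+\frac12)\theta}\,d\theta$. $H^+$ is the Riesz--Titchmarsh transform, with Fourier multiplier $(-\mathrm{i}\,\operatorname{sgn}\theta)e^{\mathrm{i}\theta/2}$. Here $\rho(\theta)\in(0,1]$ is the root in $(0,1]$ of $\rho+\rho^{-1}=4-2\cos\theta$. *)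

theory Defs
  imports "HOL-Analysis.Analysis" "HOL-Library.Landau_Symbols"
begin

(* The root in (0,1] of rho + 1/rho = 4 - 2 cos theta. *)
definition rho :: "real \<Rightarrow> real" where
  "rho \<theta> = 2 - cos \<theta> - sqrt ((2 - cos \<theta>)\<^sup>2 - 1)"

definition K_d :: "int \<Rightarrow> real" where
  "K_d n = 1 / pi * integral {0..pi} (\<lambda>\<theta>. sqrt (rho \<theta>) * sin ((of_int n + 1/2) * \<theta>))"

definition K_Hplus :: "int \<Rightarrow> real" where
  "K_Hplus n = 1 / (pi * (of_int n + 1/2))"

definition D :: "int \<Rightarrow> real" where
  "D n = K_d n - K_Hplus n"

(* The exponent p ranges over [1,\<infinity>]; the value is \<infinity> exactly for sequences outside
   the sequence space. The sum is taken in ennreal, where it always exists. *)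
definition lp_norm :: "ennreal \<Rightarrow> (int \<Rightarrow> 'a::real_normed_vector) \<Rightarrow> ennreal" where
  "lp_norm p a =
     (if p = \<infinity> then (SUP n. ennreal (norm (a n)))
      else let S = (\<Sum>\<^sub>\<infinity>n\<in>UNIV. ennreal (norm (a n) powr enn2real p))
           in if S = \<infinity> then \<infinity> else ennreal (enn2real S powr (1 / enn2real p)))"

definition lp :: "ennreal \<Rightarrow> (int \<Rightarrow> 'a::real_normed_vector) set" where
  "lp p = {a. lp_norm p a < \<infinity>}"

definition lp_opnorm ::
  "ennreal \<Rightarrow> ((int \<Rightarrow> complex) \<Rightarrow> (int \<Rightarrow> complex)) \<Rightarrow> ennreal" where
  "lp_opnorm p T = (SUP a \<in> {a. lp_norm p a \<le> 1}. lp_norm p (T a))"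

(* conv K a n is the convolution series only when conv_defined K a n holds;
   infsum returns 0 on non-summable families. *)
definition conv_defined :: "(int \<Rightarrow> real) \<Rightarrow> (int \<Rightarrow> complex) \<Rightarrow> int \<Rightarrow> bool" where
  "conv_defined K a n \<longleftrightarrow> (\<lambda>m. of_real (K (n - m)) * a m) summable_on UNIV"

definition conv :: "(int \<Rightarrow> real) \<Rightarrow> (int \<Rightarrow> complex) \<Rightarrow> (int \<Rightarrow> complex)" where
  "conv K a = (\<lambda>n. \<Sum>\<^sub>\<infinity>m\<in>UNIV. of_real (K (n - m)) * a m)"

definition H_d :: "(int \<Rightarrow> complex) \<Rightarrow> (int \<Rightarrow> complex)" where
  "H_d = conv K_d"

definition H_plus :: "(int \<Rightarrow> complex) \<Rightarrow> (int \<Rightarrow> complex)" where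
  "H_plus = conv K_Hplus"

(* The operator H_d - H^+. It is defined through its own kernel because for p = \<infinity> the series
   defining H_d and H^+ separately need not converge. *)
definition H_diff :: "(int \<Rightarrow> complex) \<Rightarrow> (int \<Rightarrow> complex)" where
  "H_diff = conv D"

end

theory Submission
  imports Defs
begin

text \<open>
  With \<open>s = sin (\<theta>/2)\<close> the multiplier is \<open>sqrt (rho \<theta>) = sqrt (1 + s\<^sup>2) - s\<close> on \<open>[0, pi]\<close>, so it is
  smooth there, equals 1 at 0, and its derivative vanishes at \<open>pi\<close>. Integrating twice by parts
  against \<open>sin (\<nu> \<theta>)\<close>, where \<open>\<nu> = n + 1/2\<close>, produces the main term \<open>1 / (pi * \<nu>)\<close>, which is
  \<open>K_Hplus n\<close>, and leaves a remainder of order \<open>1 / \<nu>\<^sup>2\<close>. Hence \<open>D\<close> is summable, and the operator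
  bound is Young's convolution inequality. For finite \<open>p\<close> the series for \<open>K_Hplus\<close> converges because
  \<open>K_Hplus\<close> lies in the conjugate sequence space.
\<close>

section \<open>Decay of the kernel difference\<close>

text \<open>The half-angle substitution \<open>cos \<theta> = 1 - 2 * s\<^sup>2\<close> factors the
  discriminant as \<open>(2 * s)\<^sup>2 * (1 + s\<^sup>2)\<close>, which makes
  \<open>rho \<theta>\<close> the perfect square of \<open>sqrt (1 + s\<^sup>2) - s\<close>. The
  range of \<open>\<theta>\<close> gives \<open>s \<ge> 0\<close>, so that the square root of
  \<open>(2 * s)\<^sup>2\<close> is \<open>2 * s\<close>.\<close>

lemma sqrt_rho:
  assumes "0 \<le> \<theta>" "\<theta> \<le> pi"
  shows "sqrt (rho \<theta>) = sqrt (1 + (sin (\<theta>/2))\<^sup>2) - sin (\<theta>/2)"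
proof -
  define s where "s = sin (\<theta>/2)"
  have s: "s \<ge> 0" unfolding s_def using assms by (intro sin_ge_zero) auto
  have c: "cos \<theta> = 1 - 2 * s\<^sup>2"
    using cos_double_sin[of "\<theta>/2"] by (simp add: s_def)
  have "(2 - cos \<theta>)\<^sup>2 - 1 = (2 * s)\<^sup>2 * (1 + s\<^sup>2)"
    unfolding c by algebra
  then have "sqrt ((2 - cos \<theta>)\<^sup>2 - 1) = 2 * s * sqrt (1 + s\<^sup>2)"
    using s by (simp add: real_sqrt_mult)
  moreover have "(sqrt (1 + s\<^sup>2))\<^sup>2 = 1 + s\<^sup>2" by simp
  ultimately have "rho \<theta> = (sqrt (1 + s\<^sup>2) - s)\<^sup>2"
    unfolding rho_def c by (simp add: power2_diff)
  moreover have "s \<le> sqrt (1 + s\<^sup>2)"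
    by (rule real_le_rsqrt) simp
  ultimately show ?thesis by (simp add: s_def)
qed

lemma cos_half_odd_pi: "cos ((of_int n + 1/2) * pi) = 0"
  unfolding cos_zero_iff_int2 by (auto intro!: exI[of _ n] simp: algebra_simps)

text \<open>No integer lies strictly between -1 and 0. The first bound permits division by the
  frequency; the second turns decay in the frequency into decay in \<open>n\<close>.\<close>

lemma half_odd_bounds:
  "1/2 \<le> \<bar>of_int n + 1/2 :: real\<bar>" "\<bar>of_int n\<bar> / 2 \<le> \<bar>of_int n + 1/2 :: real\<bar>"
proof -
  have "n \<ge> 0 \<or> n \<le> -1" by linarith
  then have "(of_int n :: real) \<ge> 0 \<or> (of_int n :: real) \<le> -1" by linarith
  then show "1/2 \<le> \<bar>of_int n + 1/2 :: real\<bar>" "\<bar>of_int n\<bar> / 2 \<le> \<bar>of_int n + 1/2 :: real\<bar>"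
    by (auto simp: field_simps abs_if)
qed

text \<open>Two integrations by parts; both boundary terms at \<open>pi\<close> vanish, the first because the
  frequency is half odd, the second because of the hypothesis on \<open>f'\<close>.\<close>

lemma integral_sin_half_odd:
  fixes f f' f'' :: "real \<Rightarrow> real" and n :: int
  defines "\<nu> \<equiv> of_int n + 1/2"
  assumes f: "\<And>x. (f has_real_derivative f' x) (at x)"
    and f': "\<And>x. (f' has_real_derivative f'' x) (at x)"
    and f'': "continuous_on {0..pi} f''" and "f' pi = 0"
  shows "integral {0..pi} (\<lambda>x. f x * sin (\<nu> * x)) =
         f 0 / \<nu> - integral {0..pi} (\<lambda>x. f'' x * sin (\<nu> * x)) / \<nu>\<^sup>2"
proof -
  have nz: "\<nu> \<noteq> 0" using half_odd_bounds(1)[of n] unfolding \<nu>_def by auto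
  \<comment> \<open>This antiderivative performs both integrations by parts at once: on
    differentiation the two \<open>f' x * cos (\<nu> * x) / \<nu>\<close> terms cancel.\<close>
  define F where "F x = f' x * sin (\<nu> * x) / \<nu>\<^sup>2 - f x * cos (\<nu> * x) / \<nu>" for x
  have "(F has_real_derivative (f x * sin (\<nu> * x) + f'' x * sin (\<nu> * x) / \<nu>\<^sup>2)) (at x)" for x
  proof -
    have "((\<lambda>x. f' x * sin (\<nu> * x) / \<nu>\<^sup>2) has_real_derivative
        (f'' x * sin (\<nu> * x) / \<nu>\<^sup>2 + f' x * cos (\<nu> * x) / \<nu>)) (at x)"
      using nz by (auto intro!: derivative_eq_intros f' simp: power2_eq_square add_divide_distrib)
    moreover have "((\<lambda>x. f x * cos (\<nu> * x) / \<nu>) has_real_derivative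
        (f' x * cos (\<nu> * x) / \<nu> - f x * sin (\<nu> * x))) (at x)"
      using nz by (auto intro!: derivative_eq_intros f simp: diff_divide_distrib)
    ultimately show ?thesis
      unfolding F_def by (rule DERIV_cong[OF DERIV_diff]) simp
  qed
  then have FTC: "((\<lambda>x. f x * sin (\<nu> * x) + f'' x * sin (\<nu> * x) / \<nu>\<^sup>2) has_integral (F pi - F 0)) {0..pi}"
    by (intro fundamental_theorem_of_calculus)
      (simp_all add: has_real_derivative_iff_has_vector_derivative has_vector_derivative_at_within)
  have F: "F pi - F 0 = f 0 / \<nu>"
    using cos_half_odd_pi[of n] \<open>f' pi = 0\<close> by (simp add: F_def \<nu>_def)
  have "((\<lambda>x. f'' x * sin (\<nu> * x) / \<nu>\<^sup>2) has_integral
      integral {0..pi} (\<lambda>x. f'' x * sin (\<nu> * x)) / \<nu>\<^sup>2) {0..pi}"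
    by (intro has_integral_divide integrable_integral integrable_continuous_interval continuous_intros f'')
  from has_integral_diff[OF FTC this] have "((\<lambda>x. f x * sin (\<nu> * x)) has_integral
      (f 0 / \<nu> - integral {0..pi} (\<lambda>x. f'' x * sin (\<nu> * x)) / \<nu>\<^sup>2)) {0..pi}"
    by (simp add: F)
  then show ?thesis by (rule integral_unique)
qed

text \<open>Bounding by the frequency instead of \<open>n\<close> gives an estimate valid for every
  integer, including 0, so it serves both for the asymptotics and for summability.\<close>

lemma D_decay: "\<exists>B. \<forall>n. \<bar>D n\<bar> \<le> B / (of_int n + 1/2)\<^sup>2"
proof -
  define r where "r x = sqrt (1 + (sin (x/2))\<^sup>2)" for x :: real
  \<comment> \<open>Agrees with \<open>sqrt (rho x)\<close> on \<open>[0, pi]\<close> but, unlike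
    that even function, has no corner at 0. Two-sided derivatives therefore exist at both
    endpoints.\<close>
  define f where "f x = r x - sin (x/2)" for x :: real
  define f' where "f' x = sin (x/2) * cos (x/2) / (2 * r x) - cos (x/2) / 2" for x :: real
  define f'' where "f'' x = ((cos (x/2))\<^sup>2 - (sin (x/2))\<^sup>2) / (4 * r x)
      - (sin (x/2))\<^sup>2 * (cos (x/2))\<^sup>2 / (4 * r x ^ 3) + sin (x/2) / 4" for x :: real
  have pos: "1 + (sin (x/2))\<^sup>2 > 0" for x :: real by (simp add: add_pos_nonneg)
  have nz: "r x \<noteq> 0" for x using pos[of x] by (simp add: r_def)
  have dr: "(r has_real_derivative sin (x/2) * cos (x/2) / (2 * r x)) (at x)" for x
  proof -
    have "((\<lambda>x. 1 + (sin (x/2))\<^sup>2) has_real_derivative sin (x/2) * cos (x/2)) (at x)"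
      by (auto intro!: derivative_eq_intros)
    from DERIV_chain2[where f = sqrt, OF DERIV_real_sqrt[OF pos] this]
    show ?thesis unfolding r_def by (rule DERIV_cong) (simp add: inverse_eq_divide)
  qed
  have df: "(f has_real_derivative f' x) (at x)" for x
    unfolding f_def f'_def by (auto intro!: derivative_eq_intros dr)
  have df': "(f' has_real_derivative f'' x) (at x)" for x
  proof -
    have "((\<lambda>x. sin (x/2) * cos (x/2)) has_real_derivative ((cos (x/2))\<^sup>2 - (sin (x/2))\<^sup>2) / 2) (at x)"
      by (auto intro!: derivative_eq_intros simp: power2_eq_square algebra_simps)
    moreover have "((\<lambda>x. 2 * r x) has_real_derivative sin (x/2) * cos (x/2) / r x) (at x)"
      by (auto intro!: derivative_eq_intros dr)
    ultimately have "((\<lambda>x. sin (x/2) * cos (x/2) / (2 * r x)) has_real_derivative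
        (((cos (x/2))\<^sup>2 - (sin (x/2))\<^sup>2) / 2 * (2 * r x) - sin (x/2) * cos (x/2) * (sin (x/2) * cos (x/2) / r x))
          / (2 * r x * (2 * r x))) (at x)"
      by (rule DERIV_divide) (simp add: nz)
    moreover have "((\<lambda>x. cos (x/2) / 2) has_real_derivative - (sin (x/2) / 4)) (at x)"
      by (auto intro!: derivative_eq_intros)
    ultimately show ?thesis
      unfolding f'_def
      by (rule DERIV_cong[OF DERIV_diff])
        (use nz[of x] in \<open>simp add: f''_def field_simps power2_eq_square power3_eq_cube\<close>)
  qed
  have cf: "continuous_on {0..pi} f''"
    unfolding f''_def
    by (intro continuous_intros continuous_on_subset[OF DERIV_continuous_on[OF dr]]) (use nz in auto)
  have "bounded (f'' ` {0..pi})"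
    by (intro compact_imp_bounded compact_continuous_image cf compact_Icc)
  then obtain B where B: "\<And>x. x \<in> {0..pi} \<Longrightarrow> \<bar>f'' x\<bar> \<le> B"
    unfolding bounded_iff real_norm_def by blast
  have B0: "B \<ge> 0" using B[of 0] by auto
  have "\<bar>D n\<bar> \<le> B / (of_int n + 1/2)\<^sup>2" for n
  proof -
    define \<nu> :: real where "\<nu> = of_int n + 1/2"
    define I where "I = integral {0..pi} (\<lambda>x. f'' x * sin (\<nu> * x))"
    have "K_d n = 1 / pi * integral {0..pi} (\<lambda>x. f x * sin (\<nu> * x))"
      unfolding K_d_def \<nu>_def
      by (intro arg_cong2[where f = "(*)"] refl integral_cong) (simp add: sqrt_rho f_def r_def)
    \<comment> \<open>Both terms of \<open>f'\<close> carry the factor \<open>cos (x/2)\<close>,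
      which vanishes at \<open>pi\<close>.\<close>
    also have "integral {0..pi} (\<lambda>x. f x * sin (\<nu> * x)) = f 0 / \<nu> - I / \<nu>\<^sup>2"
      unfolding I_def \<nu>_def by (rule integral_sin_half_odd[OF df df' cf]) (simp add: f'_def)
    \<comment> \<open>Since \<open>f 0 = 1\<close>, the boundary term divided by \<open>pi\<close>
      is exactly \<open>K_Hplus n\<close> and cancels.\<close>
    finally have "D n = - (I / pi / \<nu>\<^sup>2)"
      by (simp add: D_def K_Hplus_def f_def r_def flip: \<nu>_def) (simp add: field_simps)
    \<comment> \<open>The interval length \<open>pi\<close> cancels the prefactor
      \<open>1 / pi\<close> of \<open>K_d\<close>, so the final constant is the bound
      \<open>B\<close> for \<open>f''\<close> itself.\<close>
    moreover have "\<bar>I\<bar> \<le> B * pi"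
    proof -
      have "norm I \<le> B * measure lborel (cbox 0 pi)"
        unfolding I_def using B0
      proof (rule has_integral_bound)
        show "((\<lambda>x. f'' x * sin (\<nu> * x)) has_integral integral {0..pi} (\<lambda>x. f'' x * sin (\<nu> * x))) (cbox 0 pi)"
          unfolding cbox_interval
          by (intro integrable_integral integrable_continuous_interval continuous_intros cf)
        show "norm (f'' x * sin (\<nu> * x)) \<le> B" if "x \<in> cbox 0 pi" for x
          using mult_mono[of "\<bar>f'' x\<bar>" B "\<bar>sin (\<nu> * x)\<bar>" 1] B[of x] that B0 by (simp add: abs_mult)
      qed
      then show ?thesis by simp
    qed
    then have "\<bar>I\<bar> / pi / \<nu>\<^sup>2 \<le> B / \<nu>\<^sup>2"
      by (intro divide_right_mono) (auto simp: field_simps)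
    ultimately show ?thesis by (simp add: abs_mult \<nu>_def[symmetric])
  qed
  then show ?thesis by blast
qed

text \<open>Reflecting by \<open>- n - 1\<close> rather than \<open>- n\<close> splits the integers
  into two disjoint halves and preserves \<open>|n + 1/2|\<close>, so an even function of the half
  odd frequency gives the same series on both.\<close>

lemma summable_on_intI:
  "f summable_on (UNIV :: int set)"
  if "(\<lambda>n. f (int n)) summable_on UNIV" "(\<lambda>n. f (- int n - 1)) summable_on UNIV"
  for f :: "int \<Rightarrow> real"
proof -
  have u: "(UNIV :: int set) = range int \<union> range (\<lambda>n. - int n - 1)"
  proof -
    have "x \<in> range int \<union> range (\<lambda>n. - int n - 1)" for x
    proof (cases "x \<ge> 0")
      case True then show ?thesis by (metis UnI1 nonneg_int_cases rangeI)
    next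
      case False then have "x = - int (nat (- x - 1)) - 1" by simp
      then show ?thesis by blast
    qed
    then show ?thesis by blast
  qed
  have "f summable_on range int"
    using that(1) by (subst summable_on_reindex) (auto simp: o_def inj_def)
  moreover have "f summable_on range (\<lambda>n. - int n - 1)"
    using that(2) by (subst summable_on_reindex) (auto simp: o_def inj_def)
  ultimately show ?thesis unfolding u by (rule summable_on_union)
qed

text \<open>Needed with \<open>q = 2\<close> for \<open>D\<close> and with a conjugate exponent for
  \<open>K_Hplus\<close>.\<close>

lemma summable_half_odd_powr:
  assumes "q > 1"
  shows "(\<lambda>n::int. \<bar>of_int n + 1/2 :: real\<bar> powr (-q)) summable_on UNIV"
proof -
  have *: "(\<lambda>n::nat. (real n + 1/2) powr (-q)) summable_on UNIV"
  proof (subst summable_on_UNIV_nonneg_real_iff)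
    have "summable (\<lambda>n. real (Suc n) powr (-q))"
      using assms summable_real_powr_iff[of "-q"] by (subst summable_Suc_iff) simp
    then have "summable (\<lambda>n. real (Suc n) powr (-q) * (1/2) powr (-q))"
      by (rule summable_mult2)
    then show "summable (\<lambda>n. (real n + 1/2) powr (-q))"
    proof (rule summable_comparison_test'[of _ 0])
      fix n :: nat
      \<comment> \<open>Here \<open>n + 1/2 \<ge> (n + 1)/2\<close>, and a negative power is
        decreasing; this compares with the shifted p-series up to a constant.\<close>
      have "(real n + 1/2) powr (-q) \<le> (real (Suc n) * (1/2)) powr (-q)"
        using assms by (intro powr_mono2') auto
      then show "norm ((real n + 1/2) powr (-q)) \<le> real (Suc n) powr (-q) * (1/2) powr (-q)"
        by (simp only: powr_mult) simp
    qed
  qed simp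
  have "\<bar>real_of_int (- int n - 1) + 1/2\<bar> = real n + 1/2" "\<bar>real_of_int (int n) + 1/2\<bar> = real n + 1/2" for n
    by auto
  then show ?thesis using * by (intro summable_on_intI) simp_all
qed

text \<open>The filter expresses \<open>|n|\<close> tending to infinity in both directions. The
  factor 4 comes from squaring \<open>|n + 1/2| \<ge> |n| / 2\<close>.\<close>

lemma D_bigo:
  "(\<lambda>n. K_d n - 1 / (pi * (of_int n + 1/2)))
     \<in> O[filtercomap abs at_top](\<lambda>n::int. 1 / (of_int n)\<^sup>2)"
proof -
  obtain B where B: "\<And>n. \<bar>D n\<bar> \<le> B / (of_int n + 1/2)\<^sup>2" using D_decay by blast
  have B0: "B \<ge> 0" using B[of 0] by (simp add: field_simps)
  \<comment> \<open>At \<open>n = 0\<close> the right-hand side is 0 by the convention on division,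
    so that point is excluded.\<close>
  have "\<bar>D n\<bar> \<le> 4 * B * (1 / (of_int n)\<^sup>2)" if "\<bar>n\<bar> \<ge> 1" for n
  proof -
    have "(\<bar>of_int n\<bar> / 2)\<^sup>2 \<le> \<bar>of_int n + 1/2 :: real\<bar>\<^sup>2"
      by (intro power_mono half_odd_bounds) simp
    then have "(of_int n)\<^sup>2 / 4 \<le> (of_int n + 1/2 :: real)\<^sup>2" by (simp add: power_divide)
    then have "B / (of_int n + 1/2)\<^sup>2 \<le> B / ((of_int n)\<^sup>2 / 4)"
      using that B0 by (intro divide_left_mono) (use half_odd_bounds(1)[of n] in \<open>auto simp: zero_less_mult_iff\<close>)
    then show ?thesis using B[of n] by (simp add: mult_ac)
  qed
  then have "\<forall>\<^sub>F n in filtercomap abs at_top. \<bar>D n\<bar> \<le> 4 * B * (1 / (of_int n)\<^sup>2)"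
    unfolding eventually_filtercomap by (intro exI[of _ "\<lambda>n. n \<ge> 1"]) (auto simp: eventually_ge_at_top)
  then show ?thesis
    by (intro bigoI[of _ "4 * B"]) (simp add: D_def K_Hplus_def)
qed

lemma D_summable: "(\<lambda>n. \<bar>D n\<bar>) summable_on UNIV"
proof -
  obtain B where B: "\<And>n. \<bar>D n\<bar> \<le> B / (of_int n + 1/2)\<^sup>2" using D_decay by blast
  have "(\<lambda>n::int. B * \<bar>of_int n + 1/2 :: real\<bar> powr (-2)) summable_on UNIV"
    by (intro summable_on_cmult_right summable_half_odd_powr) simp
  moreover have "\<bar>of_int n + 1/2 :: real\<bar> powr (-2) = 1 / (of_int n + 1/2)\<^sup>2" for n
  proof -
    have "\<bar>of_int n + 1/2 :: real\<bar> > 0" using half_odd_bounds(1)[of n] by linarith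
    then have "\<bar>of_int n + 1/2 :: real\<bar> powr (-2) = 1 / \<bar>of_int n + 1/2\<bar>\<^sup>2"
      by (simp only: powr_minus powr_numeral inverse_eq_divide less_imp_le)
    then show ?thesis by simp
  qed
  ultimately have "(\<lambda>n. B / (of_int n + 1/2)\<^sup>2) summable_on UNIV" by simp
  then show ?thesis by (rule summable_on_comparison_test) (use B in auto)
qed

section \<open>Sequence spaces\<close>

text \<open>For nonnegative terms both sums are the supremum of the finite partial sums.\<close>

lemma infsum_ennreal:
  fixes f :: "'a \<Rightarrow> real"
  assumes "f summable_on A" "\<And>x. x \<in> A \<Longrightarrow> f x \<ge> 0"
  shows "(\<Sum>\<^sub>\<infinity>x\<in>A. ennreal (f x)) = ennreal (infsum f A)"
proof -
  have "(\<Sum>\<^sub>\<infinity>x\<in>A. ennreal (f x)) = (SUP F\<in>{F. finite F \<and> F \<subseteq> A}. \<Sum>x\<in>F. ennreal (f x))"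
    by (rule nonneg_infsum_complete) simp
  also have "\<dots> = (SUP F\<in>{F. finite F \<and> F \<subseteq> A}. ennreal (sum f F))"
    by (rule SUP_cong) (use assms(2) in \<open>auto intro!: sum_ennreal\<close>)
  finally show ?thesis
    by (simp add: infsum_nonneg_is_SUPREMUM_ennreal assms)
qed

text \<open>The sum in \<open>ennreal\<close> exists for every family, so its finiteness is what
  carries summability: it bounds all finite partial sums.\<close>

lemma summable_on_if_infsum_ennreal_finite:
  fixes f :: "'a \<Rightarrow> real"
  assumes fin: "(\<Sum>\<^sub>\<infinity>x\<in>A. ennreal (f x)) \<noteq> \<infinity>" and nonneg: "\<And>x. x \<in> A \<Longrightarrow> f x \<ge> 0"
  shows "f summable_on A"
proof (rule nonneg_bdd_above_summable_on[OF nonneg])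
  show "bdd_above (sum f ` {F. F \<subseteq> A \<and> finite F})"
  proof (rule bdd_aboveI2)
    fix F assume F: "F \<in> {F. F \<subseteq> A \<and> finite F}"
    have "ennreal (sum f F) = (\<Sum>x\<in>F. ennreal (f x))"
      using F nonneg by (auto intro!: sum_ennreal[symmetric])
    also have "\<dots> \<le> (\<Sum>\<^sub>\<infinity>x\<in>A. ennreal (f x))"
      unfolding nonneg_infsum_complete[OF zero_le] using F by (auto intro: SUP_upper)
    finally show "sum f F \<le> enn2real (\<Sum>\<^sub>\<infinity>x\<in>A. ennreal (f x))"
      using fin by (cases "\<Sum>\<^sub>\<infinity>x\<in>A. ennreal (f x)")
        (auto simp: ennreal_le_iff2 sum_nonneg)
  qed
qed

lemma lp_norm_real:
  assumes "r \<ge> 1" "(\<lambda>n. norm (a n) powr r) summable_on UNIV"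
  shows "lp_norm (ennreal r) a = ennreal ((\<Sum>\<^sub>\<infinity>n. norm (a n) powr r) powr (1/r))"
  using assms infsum_ennreal[OF assms(2)] by (simp add: lp_norm_def Let_def infsum_nonneg)

lemma lp_real_iff:
  assumes "r \<ge> 1"
  shows "a \<in> lp (ennreal r) \<longleftrightarrow> (\<lambda>n. norm (a n) powr r) summable_on UNIV"
proof
  assume "a \<in> lp (ennreal r)"
  then have "(\<Sum>\<^sub>\<infinity>n. ennreal (norm (a n) powr r)) \<noteq> \<infinity>"
    using assms by (auto simp: lp_def lp_norm_def Let_def split: if_splits)
  then show "(\<lambda>n. norm (a n) powr r) summable_on UNIV"
    by (rule summable_on_if_infsum_ennreal_finite) simp
next
  assume "(\<lambda>n. norm (a n) powr r) summable_on UNIV"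
  then show "a \<in> lp (ennreal r)"
    using assms by (simp add: lp_def lp_norm_real)
qed

lemma lp_infinity_iff: "a \<in> lp \<infinity> \<longleftrightarrow> (\<exists>B\<ge>0. lp_norm \<infinity> a = ennreal B \<and> (\<forall>n. norm (a n) \<le> B))"
proof
  assume "a \<in> lp \<infinity>"
  then obtain B where B: "B \<ge> 0" "lp_norm \<infinity> a = ennreal B"
    unfolding lp_def by (cases "lp_norm \<infinity> a") auto
  have "ennreal (norm (a n)) \<le> ennreal B" for n
    unfolding B(2)[symmetric] lp_norm_def by (auto intro: SUP_upper)
  then have "norm (a n) \<le> B" for n
    using B(1) by simp
  then show "\<exists>B\<ge>0. lp_norm \<infinity> a = ennreal B \<and> (\<forall>n. norm (a n) \<le> B)"
    using B by blast
qed (auto simp: lp_def)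

section \<open>Young's convolution inequality\<close>

text \<open>The tangent line of \<open>\<lambda>x. x powr r\<close> at \<open>s\<close>, up to a factor \<open>r\<close>; summed against weights with \<open>s\<close>
  their weighted mean it yields Jensen's inequality.\<close>

lemma tangent_powr:
  fixes x s r :: real
  assumes "r \<ge> 1" "x \<ge> 0" "s > 0"
  shows "x * s powr (r - 1) \<le> x powr r / r + (1 - 1/r) * s powr r"
proof (cases "r = 1")
  case False
  \<comment> \<open>The conjugate exponent: Young's inequality is applied to \<open>x\<close> and
    \<open>s powr (r - 1)\<close>, and \<open>(r - 1) * q = r\<close> restores the power
    \<open>r\<close> of \<open>s\<close>.\<close>
  define q where "q = r / (r - 1)"
  have r: "r > 1" using False assms by simp
  then have "q > 1" "1/r + 1/q = 1" "(r - 1) * q = r" "1/q = 1 - 1/r"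
    by (auto simp: q_def field_simps)
  moreover from this(3) have "(s powr (r - 1)) powr q / q = (1/q) * s powr r"
    by (simp add: powr_powr)
  ultimately show ?thesis
    using Youngs_inequality[of r q x "s powr (r - 1)"] r assms by simp
qed (use assms in auto)

text \<open>Splitting at \<open>x = 1\<close> gives \<open>x \<le> 1 + x powr r\<close>, and the
  total weight is finite.\<close>

lemma summable_on_weighted:
  fixes w x :: "'a \<Rightarrow> real"
  assumes "r \<ge> 1" "\<And>m. w m \<ge> 0" "\<And>m. x m \<ge> 0" "w summable_on UNIV"
    "(\<lambda>m. w m * x m powr r) summable_on UNIV"
  shows "(\<lambda>m. w m * x m) summable_on UNIV"
proof (rule summable_on_comparison_test)
  show "(\<lambda>m. w m + w m * x m powr r) summable_on UNIV"
    by (intro summable_on_add assms)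
  have "x m \<le> 1 + x m powr r" for m
  proof (cases "x m \<le> 1")
    case False
    then show ?thesis using powr_mono[of 1 r "x m"] assms(1) by simp
  qed (simp add: add_increasing2)
  then show "w m * x m \<le> w m + w m * x m powr r" for m
    using mult_left_mono[of "x m" "1 + x m powr r" "w m"] assms(2) by (simp add: distrib_left)
qed (use assms in auto)

text \<open>Jensen's inequality \<open>(S / W) powr r \<le> T / W\<close> for weights of total mass
  \<open>W\<close>, cleared of denominators so that it also covers \<open>W = 0\<close>.\<close>

lemma infsum_weighted_powr_le:
  fixes w x :: "'a \<Rightarrow> real"
  assumes "r \<ge> 1" "\<And>m. w m \<ge> 0" "\<And>m. x m \<ge> 0" "w summable_on UNIV"
    "(\<lambda>m. w m * x m powr r) summable_on UNIV"
  shows "(\<Sum>\<^sub>\<infinity>m. w m * x m) powr r \<le>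
    (\<Sum>\<^sub>\<infinity>m. w m) powr (r - 1) * (\<Sum>\<^sub>\<infinity>m. w m * x m powr r)"
proof -
  define W S T where "W = (\<Sum>\<^sub>\<infinity>m. w m)" and "S = (\<Sum>\<^sub>\<infinity>m. w m * x m)"
    and "T = (\<Sum>\<^sub>\<infinity>m. w m * x m powr r)"
  have nn: "W \<ge> 0" "S \<ge> 0" "T \<ge> 0"
    unfolding W_def S_def T_def using assms by (auto intro!: infsum_nonneg)
  note sS = summable_on_weighted[OF assms]
  have "S powr r \<le> W powr (r - 1) * T"
  proof (cases "S = 0")
    case False
    have "W \<noteq> 0"
    proof
      assume "W = 0"
      then have "w m = 0" for m
        using nonneg_infsum_le_0D[of w UNIV m] assms by (simp add: W_def)
      then show False using False by (simp add: S_def)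
    qed
    then have W: "W > 0" using nn by simp
    \<comment> \<open>At the weighted mean \<open>S * s powr (r - 1) = W * s powr r\<close>. The
      summed tangent inequality then bounds this by \<open>T / r\<close> plus the fraction
      \<open>1 - 1/r\<close> of itself, which gives \<open>W * s powr r \<le> T\<close>.\<close>
    define s where "s = S / W"
    have s: "s > 0" using False W nn by (simp add: s_def)
    have eq: "S = W * s" using W by (simp add: s_def)
    have "S * s powr (r - 1) = (\<Sum>\<^sub>\<infinity>m. w m * x m * s powr (r - 1))"
      unfolding S_def by (simp add: infsum_cmult_left')
    also have "\<dots> \<le> (\<Sum>\<^sub>\<infinity>m. w m * x m powr r * (1/r) + w m * ((1 - 1/r) * s powr r))"
    proof (intro infsum_mono summable_on_add summable_on_cmult_left sS assms)
      fix m
      show "w m * x m * s powr (r - 1) \<le> w m * x m powr r * (1/r) + w m * ((1 - 1/r) * s powr r)"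
        using mult_left_mono[OF tangent_powr[OF assms(1,3) s, of m] assms(2)[of m]]
        by (simp add: distrib_left mult_ac)
    qed
    also have "\<dots> = T * (1/r) + W * ((1 - 1/r) * s powr r)"
      unfolding T_def W_def
      by (subst infsum_add[OF summable_on_cmult_left summable_on_cmult_left])
        (simp_all only: infsum_cmult_left' assms)
    also have "S * s powr (r - 1) = W * s powr r"
      using s by (simp add: eq powr_diff)
    finally have "W * s powr r \<le> T" using assms(1) by (simp add: field_simps)
    then have "W powr (r - 1) * (W * s powr r) \<le> W powr (r - 1) * T"
      by (rule mult_left_mono) simp
    moreover have "S powr r = W powr (r - 1) * (W * s powr r)"
      using W s by (simp add: eq powr_mult powr_diff)
    ultimately show ?thesis by simp
  qed (use nn in auto)
  then show ?thesis by (simp add: W_def S_def T_def)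
qed

section \<open>Convolution with a summable kernel\<close>

lemma bij_minus_left: "bij_betw ((-) (n::int)) UNIV UNIV"
  by (rule bij_betwI[of _ _ _ "(-) n"]) auto

lemma bij_minus_right: "bij_betw (\<lambda>n::int. n - m) UNIV UNIV"
  by (rule bij_betwI[of _ _ _ "\<lambda>n. n + m"]) auto

context
  fixes w :: "int \<Rightarrow> real" and W :: real
  assumes w: "(\<lambda>k. \<bar>w k\<bar>) summable_on UNIV"
  defines "W \<equiv> \<Sum>\<^sub>\<infinity>k. \<bar>w k\<bar>"
begin

text \<open>Translation and reflection of the integers preserve the sum. Row sums supply the weights
  for Jensen's inequality at fixed \<open>n\<close>; column sums serve the interchange of
  summations.\<close>

lemma kernel_row_sum: "(\<lambda>m. \<bar>w (n - m)\<bar>) summable_on UNIV" "(\<Sum>\<^sub>\<infinity>m. \<bar>w (n - m)\<bar>) = W"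
  unfolding W_def
  using w summable_on_reindex_bij_betw[OF bij_minus_left, of "\<lambda>k. \<bar>w k\<bar>" n]
    infsum_reindex_bij_betw[OF bij_minus_left, of "\<lambda>k. \<bar>w k\<bar>" n] by simp_all

lemma kernel_column_sum: "(\<lambda>n. \<bar>w (n - m)\<bar>) summable_on UNIV" "(\<Sum>\<^sub>\<infinity>n. \<bar>w (n - m)\<bar>) = W"
  unfolding W_def
  using w summable_on_reindex_bij_betw[OF bij_minus_right, of "\<lambda>k. \<bar>w k\<bar>" m]
    infsum_reindex_bij_betw[OF bij_minus_right, of "\<lambda>k. \<bar>w k\<bar>" m] by simp_all

lemma kernel_norm_nonneg: "W \<ge> 0"
  unfolding W_def by (rule infsum_nonneg) simp

text \<open>Tonelli's argument: with \<open>m\<close> fixed, the sum over \<open>n\<close> is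
  \<open>W * f m\<close>, which is summable in \<open>m\<close>. Hence the double family is summable
  and the order may be exchanged.\<close>

lemma convolution_summable:
  fixes f :: "int \<Rightarrow> real"
  assumes f: "f summable_on UNIV" "\<And>m. f m \<ge> 0"
  shows "(\<lambda>m. \<bar>w (n - m)\<bar> * f m) summable_on UNIV"
    "(\<lambda>n. \<Sum>\<^sub>\<infinity>m. \<bar>w (n - m)\<bar> * f m) summable_on UNIV"
    "(\<Sum>\<^sub>\<infinity>n. \<Sum>\<^sub>\<infinity>m. \<bar>w (n - m)\<bar> * f m) = W * (\<Sum>\<^sub>\<infinity>m. f m)"
proof -
  have "(\<lambda>(m, n). \<bar>w (n - m)\<bar> * f m) summable_on UNIV \<times> UNIV"
  proof (rule summable_on_SigmaI)
    show "((\<lambda>n. case (m, n) of (m, n) \<Rightarrow> \<bar>w (n - m)\<bar> * f m) has_sum (W * f m)) UNIV" for m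
      using has_sum_infsum[OF kernel_column_sum(1)[of m]] by (auto simp: kernel_column_sum(2) intro: has_sum_cmult_left)
    show "(\<lambda>m. W * f m) summable_on UNIV"
      by (intro summable_on_cmult_right f)
  qed (use f in auto)
  then have s: "(\<lambda>(n, m). \<bar>w (n - m)\<bar> * f m) summable_on UNIV \<times> UNIV"
    by (subst summable_on_swap) (simp add: case_prod_beta)
  show "(\<lambda>m. \<bar>w (n - m)\<bar> * f m) summable_on UNIV"
    using summable_on_SigmaD1[OF s] by simp
  show "(\<lambda>n. \<Sum>\<^sub>\<infinity>m. \<bar>w (n - m)\<bar> * f m) summable_on UNIV"
    using summable_on_Sigma_banach[OF s] by simp
  have "(\<Sum>\<^sub>\<infinity>n. \<Sum>\<^sub>\<infinity>m. \<bar>w (n - m)\<bar> * f m) = (\<Sum>\<^sub>\<infinity>m. \<Sum>\<^sub>\<infinity>n. \<bar>w (n - m)\<bar> * f m)"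
    by (rule infsum_swap_banach[OF s])
  also have "\<dots> = W * (\<Sum>\<^sub>\<infinity>m. f m)"
    by (simp add: infsum_cmult_left' infsum_cmult_right' kernel_column_sum)
  finally show "(\<Sum>\<^sub>\<infinity>n. \<Sum>\<^sub>\<infinity>m. \<bar>w (n - m)\<bar> * f m) = W * (\<Sum>\<^sub>\<infinity>m. f m)" .
qed

lemma conv_bound:
  assumes "(\<lambda>m. \<bar>w (n - m)\<bar> * norm (a m)) summable_on UNIV"
  shows "conv_defined w a n" "norm (conv w a n) \<le> (\<Sum>\<^sub>\<infinity>m. \<bar>w (n - m)\<bar> * norm (a m))"
proof -
  have *: "(\<lambda>m. norm (complex_of_real (w (n - m)) * a m)) summable_on UNIV"
    using assms by (simp add: norm_mult)
  show "conv_defined w a n"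
    unfolding conv_defined_def by (rule abs_summable_summable[OF *])
  show "norm (conv w a n) \<le> (\<Sum>\<^sub>\<infinity>m. \<bar>w (n - m)\<bar> * norm (a m))"
    unfolding conv_def using norm_infsum_bound[OF *] by (simp add: norm_mult)
qed

text \<open>Jensen's inequality at each \<open>n\<close>, with weights \<open>|w (n - m)|\<close>,
  contributes \<open>W powr (r - 1)\<close>; summing over \<open>n\<close> contributes one more
  factor \<open>W\<close>. The \<open>r\<close>-th root of the resulting \<open>W powr r\<close> is
  \<open>W\<close>.\<close>

lemma Young_convolution_real:
  assumes r: "r \<ge> 1" and a: "a \<in> lp (ennreal r)"
  shows "conv_defined w a n" "conv w a \<in> lp (ennreal r)"
    "lp_norm (ennreal r) (conv w a) \<le> ennreal W * lp_norm (ennreal r) a"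
proof -
  define f where "f m = norm (a m) powr r" for m
  have f: "f summable_on UNIV" "\<And>m. f m \<ge> 0"
    using a r by (simp_all add: lp_real_iff f_def[abs_def])
  note c = convolution_summable[OF f]
  have sx: "(\<lambda>m. \<bar>w (n - m)\<bar> * norm (a m)) summable_on UNIV" for n
    by (rule summable_on_weighted[OF r _ _ kernel_row_sum(1)]) (use c(1)[of n] in \<open>auto simp: f_def\<close>)
  show "conv_defined w a n" by (rule conv_bound[OF sx])
  have le: "norm (conv w a n) powr r \<le> W powr (r - 1) * (\<Sum>\<^sub>\<infinity>m. \<bar>w (n - m)\<bar> * f m)" for n
  proof -
    have "norm (conv w a n) powr r \<le> (\<Sum>\<^sub>\<infinity>m. \<bar>w (n - m)\<bar> * norm (a m)) powr r"
      using r conv_bound(2)[OF sx] by (intro powr_mono2) auto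
    also have "\<dots> \<le> (\<Sum>\<^sub>\<infinity>m. \<bar>w (n - m)\<bar>) powr (r - 1) * (\<Sum>\<^sub>\<infinity>m. \<bar>w (n - m)\<bar> * f m)"
      unfolding f_def by (rule infsum_weighted_powr_le[OF r _ _ kernel_row_sum(1)]) (use c(1)[of n] in \<open>auto simp: f_def\<close>)
    finally show ?thesis by (simp add: kernel_row_sum)
  qed
  have sr: "(\<lambda>n. W powr (r - 1) * (\<Sum>\<^sub>\<infinity>m. \<bar>w (n - m)\<bar> * f m)) summable_on UNIV"
    by (intro summable_on_cmult_right c)
  have sc: "(\<lambda>n. norm (conv w a n) powr r) summable_on UNIV"
    by (rule summable_on_comparison_test[OF sr]) (use le in auto)
  then show "conv w a \<in> lp (ennreal r)" using r by (simp add: lp_real_iff)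
  have F: "(\<Sum>\<^sub>\<infinity>m. f m) \<ge> 0" using f by (intro infsum_nonneg)
  have "(\<Sum>\<^sub>\<infinity>n. norm (conv w a n) powr r) \<le> W powr (r - 1) * (W * (\<Sum>\<^sub>\<infinity>m. f m))"
    using infsum_mono[OF sc sr le] by (simp add: infsum_cmult_right' c(3))
  \<comment> \<open>Combining the powers cancels a factor \<open>W\<close>; for \<open>W = 0\<close>
    both sides are 0.\<close>
  also have "\<dots> = W powr r * (\<Sum>\<^sub>\<infinity>m. f m)"
    using kernel_norm_nonneg by (cases "W = 0") (simp_all add: powr_diff)
  finally have "(\<Sum>\<^sub>\<infinity>n. norm (conv w a n) powr r) powr (1/r) \<le> (W powr r * (\<Sum>\<^sub>\<infinity>m. f m)) powr (1/r)"
    using r by (intro powr_mono2 infsum_nonneg) auto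
  also have "\<dots> = W * (\<Sum>\<^sub>\<infinity>m. f m) powr (1/r)"
    using r kernel_norm_nonneg F by (simp add: powr_mult powr_powr)
  finally have "ennreal ((\<Sum>\<^sub>\<infinity>n. norm (conv w a n) powr r) powr (1/r)) \<le> ennreal (W * (\<Sum>\<^sub>\<infinity>m. f m) powr (1/r))"
    by (rule ennreal_leI)
  then show "lp_norm (ennreal r) (conv w a) \<le> ennreal W * lp_norm (ennreal r) a"
    using r f(1) sc kernel_norm_nonneg by (simp add: lp_norm_real f_def[abs_def] ennreal_mult)
qed

lemma Young_convolution_infinity:
  assumes a: "a \<in> lp \<infinity>"
  shows "conv_defined w a n" "conv w a \<in> lp \<infinity>"
    "lp_norm \<infinity> (conv w a) \<le> ennreal W * lp_norm \<infinity> a"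
proof -
  obtain B where B: "B \<ge> 0" "lp_norm \<infinity> a = ennreal B" "\<And>n. norm (a n) \<le> B"
    using a lp_infinity_iff by blast
  have sB: "(\<lambda>m. \<bar>w (n - m)\<bar> * B) summable_on UNIV" for n
    by (intro summable_on_cmult_left kernel_row_sum)
  have sx: "(\<lambda>m. \<bar>w (n - m)\<bar> * norm (a m)) summable_on UNIV" for n
    by (rule summable_on_comparison_test[OF sB]) (use B in \<open>auto intro: mult_left_mono\<close>)
  show "conv_defined w a n" by (rule conv_bound[OF sx])
  have "norm (conv w a n) \<le> W * B" for n
  proof -
    have "norm (conv w a n) \<le> (\<Sum>\<^sub>\<infinity>m. \<bar>w (n - m)\<bar> * norm (a m))"
      by (rule conv_bound[OF sx])
    also have "\<dots> \<le> (\<Sum>\<^sub>\<infinity>m. \<bar>w (n - m)\<bar> * B)"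
      by (rule infsum_mono[OF sx sB]) (use B in \<open>auto intro: mult_left_mono\<close>)
    finally show ?thesis by (simp add: infsum_cmult_left' kernel_row_sum)
  qed
  then have le: "lp_norm \<infinity> (conv w a) \<le> ennreal (W * B)"
    by (auto simp: lp_norm_def intro!: SUP_least ennreal_leI)
  then show "lp_norm \<infinity> (conv w a) \<le> ennreal W * lp_norm \<infinity> a"
    using B kernel_norm_nonneg by (simp add: ennreal_mult)
  show "conv w a \<in> lp \<infinity>"
    unfolding lp_def mem_Collect_eq by (rule order_le_less_trans[OF le]) simp
qed

lemma Young_convolution:
  assumes p: "1 \<le> p" and a: "a \<in> lp p"
  shows "conv_defined w a n" "conv w a \<in> lp p"
    "lp_norm p (conv w a) \<le> ennreal W * lp_norm p a"
proof -
  have "conv_defined w a n \<and> conv w a \<in> lp p \<and> lp_norm p (conv w a) \<le> ennreal W * lp_norm p a"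
  proof (cases p)
    case (real r)
    then have "r \<ge> 1" using p by (simp flip: ennreal_1)
    then show ?thesis using Young_convolution_real a real by simp
  next
    case top
    then show ?thesis using Young_convolution_infinity a by simp
  qed
  then show "conv_defined w a n" "conv w a \<in> lp p"
    "lp_norm p (conv w a) \<le> ennreal W * lp_norm p a" by blast+
qed

lemma lp_opnorm_conv_le:
  assumes "1 \<le> p"
  shows "lp_opnorm p (conv w) \<le> ennreal W"
  unfolding lp_opnorm_def
proof (rule SUP_least)
  fix a :: "int \<Rightarrow> complex" assume a: "a \<in> {a. lp_norm p a \<le> 1}"
  then have "a \<in> lp p"
    by (auto simp: lp_def intro: order_le_less_trans)
  then have "lp_norm p (conv w a) \<le> ennreal W * lp_norm p a"
    by (rule Young_convolution[OF assms])
  also have "\<dots> \<le> ennreal W * 1"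
    using a by (intro mult_left_mono) auto
  finally show "lp_norm p (conv w a) \<le> ennreal W" by simp
qed

end

section \<open>The l^1 norm of the kernel and the separate series for finite exponents\<close>

lemma lp_norm_1:
  assumes "(\<lambda>k. \<bar>w k\<bar>) summable_on UNIV"
  shows "lp_norm 1 w = ennreal (\<Sum>\<^sub>\<infinity>k. \<bar>w k\<bar>)"
  using lp_norm_real[of 1 w] assms by (simp add: infsum_nonneg)

text \<open>\<open>K_Hplus\<close> decays only like \<open>1 / |n|\<close> and is not absolutely
  summable, so Young's convolution inequality does not apply. It is, however, bounded and
  \<open>q\<close>-summable for every \<open>q > 1\<close>, which covers all conjugate exponents of
  finite \<open>p\<close>.\<close>

lemma conv_defined_K_Hplus:
  assumes p: "1 \<le> p" "p < \<infinity>" and a: "a \<in> lp p"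
  shows "conv_defined K_Hplus a n"
proof -
  obtain r where r: "r \<ge> 1" "p = ennreal r"
    using p by (cases p) (auto simp flip: ennreal_1)
  have sa: "(\<lambda>m. norm (a m) powr r) summable_on UNIV"
    using a r by (simp add: lp_real_iff)
  have KH: "\<bar>K_Hplus n\<bar> = 1 / (pi * \<bar>of_int n + 1/2\<bar>)" for n
    by (simp add: K_Hplus_def abs_mult)
  have "(\<lambda>m. \<bar>K_Hplus (n - m)\<bar> * norm (a m)) summable_on UNIV"
  proof (cases "r = 1")
    case True
    \<comment> \<open>The conjugate of 1 is infinity, so boundedness is enough; the bound 1 follows
      from \<open>pi \<ge> 2\<close> and \<open>|k + 1/2| \<ge> 1/2\<close>.\<close>
    have "\<bar>K_Hplus k\<bar> \<le> 1" for k
    proof -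
      have "1 \<le> 2 * (1/2 :: real)" by simp
      also have "\<dots> \<le> pi * \<bar>of_int k + 1/2\<bar>"
        using pi_ge_two half_odd_bounds(1)[of k] by (intro mult_mono) auto
      finally show ?thesis by (simp add: KH)
    qed
    then show ?thesis
      using sa True by (intro summable_on_comparison_test[OF sa]) (auto intro: mult_left_le_one_le)
  next
    case False
    define q where "q = r / (r - 1)"
    have r1: "r > 1" and q: "q > 1" "1/q + 1/r = 1"
      using False r by (auto simp: q_def field_simps)
    have "(\<lambda>k::int. (1/pi) powr q * \<bar>of_int k + 1/2 :: real\<bar> powr (-q)) summable_on UNIV"
      by (intro summable_on_cmult_right summable_half_odd_powr q)
    moreover have "(1/pi) powr q * \<bar>of_int k + 1/2 :: real\<bar> powr (-q) = \<bar>K_Hplus k\<bar> powr q" for k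
      by (simp add: KH powr_minus powr_divide powr_mult field_simps)
    ultimately have "(\<lambda>k. \<bar>K_Hplus k\<bar> powr q) summable_on UNIV" by simp
    then have "(\<lambda>m. \<bar>K_Hplus (n - m)\<bar> powr q) summable_on UNIV"
      using summable_on_reindex_bij_betw[OF bij_minus_left, of "\<lambda>k. \<bar>K_Hplus k\<bar> powr q" n] by simp
    \<comment> \<open>Only convergence is wanted, so the termwise Young inequality replaces
      Hoelder's inequality.\<close>
    then have "(\<lambda>m. \<bar>K_Hplus (n - m)\<bar> powr q * (1/q) + norm (a m) powr r * (1/r)) summable_on UNIV"
      by (intro summable_on_add summable_on_cmult_left sa)
    then show ?thesis
      by (rule summable_on_comparison_test) (use Youngs_inequality[of q r] q r1 in auto)
  qed
  then have "(\<lambda>m. norm (complex_of_real (K_Hplus (n - m)) * a m)) summable_on UNIV"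
    by (simp add: norm_mult)
  then show ?thesis
    unfolding conv_defined_def by (rule abs_summable_summable)
qed

text \<open>Convergence of both series matters because \<open>infsum\<close> returns 0 on a
  divergent one, which would spoil additivity.\<close>

lemma conv_add:
  assumes "conv_defined K a n" "conv_defined L a n"
  shows "conv_defined (\<lambda>k. K k + L k) a n" "conv (\<lambda>k. K k + L k) a n = conv K a n + conv L a n"
  using assms summable_on_add infsum_add unfolding conv_defined_def conv_def
  by (fastforce simp: distrib_right)+

theorem lemma4p2:
  "D \<in> lp 1
   \<and> (\<lambda>n. K_d n - 1 / (pi * (of_int n + 1/2)))
        \<in> O[filtercomap abs at_top](\<lambda>n::int. 1 / (of_int n)\<^sup>2)
   \<and> (\<forall>p::ennreal. 1 \<le> p \<longrightarrow>
        (\<forall>a\<in>lp p. (\<forall>n. conv_defined D a n) \<and> H_diff a \<in> lp p)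
        \<and> lp_opnorm p H_diff \<le> lp_norm 1 D \<and> lp_norm 1 D < \<infinity>)
   \<and> (\<forall>p::ennreal. 1 \<le> p \<and> p < \<infinity> \<longrightarrow>
        (\<forall>a\<in>lp p. \<forall>n. conv_defined K_d a n \<and> conv_defined K_Hplus a n
           \<and> H_d a n - H_plus a n = H_diff a n))"
proof -
  have norm: "lp_norm 1 D = ennreal (\<Sum>\<^sub>\<infinity>k. \<bar>D k\<bar>)"
    by (rule lp_norm_1[OF D_summable])
  have fin: "lp_norm 1 D < \<infinity>" by (simp add: norm)
  note Young = Young_convolution[OF D_summable] lp_opnorm_conv_le[OF D_summable]
  \<comment> \<open>Convergence of the \<open>K_d\<close> series is inherited from those of
    \<open>D\<close> and \<open>K_Hplus\<close>.\<close>
  have Kd: "K_d = (\<lambda>k. D k + K_Hplus k)" by (simp add: D_def)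
  have "conv_defined K_d a n \<and> conv_defined K_Hplus a n \<and> H_d a n - H_plus a n = H_diff a n"
    if "1 \<le> p" "p < \<infinity>" "a \<in> lp p" for p a n
    using conv_add[OF Young(1)[OF that(1,3)] conv_defined_K_Hplus[OF that], of n]
      conv_defined_K_Hplus[OF that] unfolding Kd[symmetric]
    by (simp add: H_d_def H_plus_def H_diff_def)
  moreover have "D \<in> lp 1" using fin by (simp add: lp_def)
  moreover have "(\<forall>n. conv_defined D a n) \<and> H_diff a \<in> lp p" if "1 \<le> p" "a \<in> lp p" for p a
    using Young(1,2)[OF that] by (simp add: H_diff_def)
  moreover have "lp_opnorm p H_diff \<le> lp_norm 1 D" if "1 \<le> p" for p
    using Young(4)[OF that] by (simp add: H_diff_def norm)
  ultimately show ?thesis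
    using D_bigo fin by (intro conjI allI impI ballI) blast+
qed

end
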